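(* Let $X$ be a set of cardinality $|X|\ge 3$ and let $G$ be a subgroup of the symmetric group $S(X)$ with $S_\omega(X)\subset G$. Then the equality $\mathcal T_p=\mathfrak T_G$ of topologies on $G$ holds if and only if $G=S_\omega(X)$.
   Context: $S(X)$ is the group of all bijections of $X$ under composition; $S_\omega(X)\subset S(X)$ is the subgroup of permutations $f$ with finite support $\{x\in X:f(x)\ne x\}$. $\mathcal T_p$ is the topology of pointwise convergence on $G$, i.e. the subspace topology inherited from the Tychonoff power $X^X$ where $X$ is discrete. The centralizer topology $\mathfrak T_G$ on a group $G$ is generated by the sub-base consisting of the sets $\{x\in G: xbx^{-1}=aba^{-1}\}$, where $a,b\in G$. *)

theory Defs
  imports "HOL-Analysis.Function_Topology" "HOL-Algebra.Bij"
begin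

text \<open>
  The symmetric group of \<open>X\<close> is \<^const>\<open>BijGroup\<close>, whose elements are the bijections of \<open>X\<close>
  extended by \<^const>\<open>undefined\<close> outside \<open>X\<close>; hence they are points of the product topology
  indexed by \<open>X\<close>.
\<close>

definition finitary_perms :: "'a set \<Rightarrow> ('a \<Rightarrow> 'a) set" where
  "finitary_perms X = {f \<in> carrier (BijGroup X). finite {x \<in> X. f x \<noteq> x}}"

definition pointwise_topology :: "'a set \<Rightarrow> ('a \<Rightarrow> 'a) set \<Rightarrow> ('a \<Rightarrow> 'a) topology" where
  "pointwise_topology X G = subtopology (product_topology (\<lambda>_. discrete_topology X) X) G"

text \<open>
  The library's \<^const>\<open>topology_generated_by\<close> takes the union of the given sub-base as the
  whole space. That union is \<open>carrier G\<close> here, since \<open>a\<close> lies in the set given by \<open>a\<close> and \<open>b\<close>.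
\<close>

definition centralizer_topology :: "('g, 'm) monoid_scheme \<Rightarrow> 'g topology" where
  "centralizer_topology G = topology_generated_by
    {{x \<in> carrier G. x \<otimes>\<^bsub>G\<^esub> b \<otimes>\<^bsub>G\<^esub> inv\<^bsub>G\<^esub> x = a \<otimes>\<^bsub>G\<^esub> b \<otimes>\<^bsub>G\<^esub> inv\<^bsub>G\<^esub> a} | a b.
      a \<in> carrier G \<and> b \<in> carrier G}"

end

theory Submission
  imports Defs "HOL-Combinatorics.Transposition"
begin

text \<open>
  Put \<open>c = a b a\<inverse>\<close>; then \<open>g b g\<inverse> = c\<close> depends only on how \<open>g\<close> acts on the support of \<open>b\<close>,
  so for finitary \<open>b\<close> the sub-basic sets of the centralizer topology are pointwise open.
  Conversely, if \<open>x, u, v\<close> are distinct, the conjugates of the transpositions \<open>(x u)\<close> and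
  \<open>(x v)\<close> by \<open>g\<close> determine \<open>g x\<close>, the only point moved by both; hence the pointwise topology is
  always the coarser one. Finally, if the centralizer of \<open>b\<close> is a pointwise neighbourhood of the
  identity, then \<open>b\<close> commutes with every transposition of points outside some finite set \<open>F\<close>, which
  is impossible when \<open>b\<close> moves infinitely many points.
\<close>

section \<open>Basic neighbourhoods in the pointwise topology\<close>

lemma openin_pointwise_topology:
  assumes "G \<subseteq> X \<rightarrow>\<^sub>E X"
  shows "openin (pointwise_topology X G) S \<longleftrightarrow>
    S \<subseteq> G \<and> (\<forall>f\<in>S. \<exists>F. finite F \<and> F \<subseteq> X \<and> {g \<in> G. \<forall>x\<in>F. g x = f x} \<subseteq> S)"
proof
  assume "openin (pointwise_topology X G) S"
  then obtain T where T: "openin (product_topology (\<lambda>_. discrete_topology X) X) T" "S = T \<inter> G"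
    by (auto simp: pointwise_topology_def openin_subtopology)
  have "\<exists>F. finite F \<and> F \<subseteq> X \<and> {g \<in> G. \<forall>x\<in>F. g x = f x} \<subseteq> S" if "f \<in> S" for f
  proof -
    from that T(2) have "f \<in> T" by blast
    with T(1) obtain U where U: "finite {i \<in> X. U i \<noteq> X}" "f \<in> Pi\<^sub>E X U" "Pi\<^sub>E X U \<subseteq> T"
      unfolding openin_product_topology_alt by auto
    \<comment> \<open>Sides of the box equal to \<open>X\<close> impose nothing, because elements of
      \<open>G\<close> take values in \<open>X\<close>. The finitely many other indices form the
      required set \<open>F\<close>.\<close>
    have "g \<in> Pi\<^sub>E X U" if "g \<in> G" "\<forall>x\<in>{i \<in> X. U i \<noteq> X}. g x = f x" for g
    proof (rule PiE_I)
      fix x assume "x \<in> X"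
      show "g x \<in> U x"
      proof (cases "U x = X")
        case True
        then show ?thesis using that(1) assms \<open>x \<in> X\<close> by auto
      next
        case False
        then show ?thesis using that(2) U(2) \<open>x \<in> X\<close> by auto
      qed
    next
      fix x assume "x \<notin> X"
      then show "g x = undefined" using that(1) assms by (auto simp: PiE_def extensional_def)
    qed
    then show ?thesis
      using U T(2) by (intro exI[of _ "{i \<in> X. U i \<noteq> X}"]) blast
  qed
  then show "S \<subseteq> G \<and> (\<forall>f\<in>S. \<exists>F. finite F \<and> F \<subseteq> X \<and> {g \<in> G. \<forall>x\<in>F. g x = f x} \<subseteq> S)"
    using T(2) by blast
next
  assume R: "S \<subseteq> G \<and> (\<forall>f\<in>S. \<exists>F. finite F \<and> F \<subseteq> X \<and> {g \<in> G. \<forall>x\<in>F. g x = f x} \<subseteq> S)"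
  then obtain F where
    "\<forall>f\<in>S. finite (F f) \<and> F f \<subseteq> X \<and> {g \<in> G. \<forall>x\<in>F f. g x = f x} \<subseteq> S"
    using bchoice[OF conjunct2[OF R]] by blast
  then have F: "finite (F f)" "F f \<subseteq> X" "{g \<in> G. \<forall>x\<in>F f. g x = f x} \<subseteq> S"
    if "f \<in> S" for f
    using that by simp_all
  \<comment> \<open>This box fixes the values of \<open>f\<close> on \<open>F f\<close> and leaves
    all others free, so its trace on \<open>G\<close> is the set of \<open>g\<close> agreeing with
    \<open>f\<close> on \<open>F f\<close>.\<close>
  define U where "U f = Pi\<^sub>E X (\<lambda>x. if x \<in> F f then {f x} else X)" for f
  have f: "f \<in> X \<rightarrow>\<^sub>E X" if "f \<in> S" for f using R assms that by blast
  have "openin (product_topology (\<lambda>_. discrete_topology X) X) (U f)" if "f \<in> S" for f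
    unfolding U_def openin_PiE_gen
  proof (rule disjI2, intro conjI ballI)
    show "finite {i \<in> X. (if i \<in> F f then {f i} else X) \<noteq> topspace (discrete_topology X)}"
      by (rule finite_subset[OF _ F(1)[OF that]]) auto
  qed (use f[OF that] in auto)
  then have "openin (product_topology (\<lambda>_. discrete_topology X) X) (\<Union>f\<in>S. U f)"
    by blast
  moreover have "S = (\<Union>f\<in>S. U f) \<inter> G"
  proof
    show "S \<subseteq> (\<Union>f\<in>S. U f) \<inter> G"
      using f R by (force simp: U_def)
    show "(\<Union>f\<in>S. U f) \<inter> G \<subseteq> S"
    proof
      fix g assume "g \<in> (\<Union>f\<in>S. U f) \<inter> G"
      then obtain f where "f \<in> S" "g \<in> U f" "g \<in> G" by blast
      moreover have "g x = f x" if "x \<in> F f" for x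
        using PiE_mem[OF \<open>g \<in> U f\<close>[unfolded U_def], of x] F(2)[OF \<open>f \<in> S\<close>] that by auto
      ultimately show "g \<in> S" using F(3) by blast
    qed
  qed
  ultimately show "openin (pointwise_topology X G) S"
    by (auto simp: pointwise_topology_def openin_subtopology)
qed

section \<open>Conjugation in the symmetric group\<close>

lemma mult_BijGroup_apply:
  assumes "f \<in> Bij X" "g \<in> Bij X" "x \<in> X"
  shows "(f \<otimes>\<^bsub>BijGroup X\<^esub> g) x = f (g x)"
  using assms by (simp add: BijGroup_def compose_def)

text \<open>Multiplying by \<open>g\<close> on the right removes the inverse; both products are
  extensional, so comparing them on \<open>X\<close> is enough.\<close>

lemma conjugate_BijGroup_eq_iff:
  assumes "g \<in> Bij X" "b \<in> Bij X" "c \<in> Bij X"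
  shows "g \<otimes>\<^bsub>BijGroup X\<^esub> b \<otimes>\<^bsub>BijGroup X\<^esub> inv\<^bsub>BijGroup X\<^esub> g = c \<longleftrightarrow>
    (\<forall>x\<in>X. g (b x) = c (g x))"
proof -
  interpret group "BijGroup X" by (rule group_BijGroup)
  have car: "carrier (BijGroup X) = Bij X" by (simp add: BijGroup_def)
  have "g \<otimes>\<^bsub>BijGroup X\<^esub> b \<otimes>\<^bsub>BijGroup X\<^esub> inv\<^bsub>BijGroup X\<^esub> g = c \<longleftrightarrow>
    g \<otimes>\<^bsub>BijGroup X\<^esub> b = c \<otimes>\<^bsub>BijGroup X\<^esub> g"
    using assms inv_solve_right'[of c "g \<otimes>\<^bsub>BijGroup X\<^esub> b" g] m_closed[of g b] by (simp add: car)
  also have "\<dots> \<longleftrightarrow> (\<forall>x\<in>X. g (b x) = c (g x))"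
  proof
    assume "g \<otimes>\<^bsub>BijGroup X\<^esub> b = c \<otimes>\<^bsub>BijGroup X\<^esub> g"
    then show "\<forall>x\<in>X. g (b x) = c (g x)"
      using assms mult_BijGroup_apply by metis
  next
    have "g \<otimes>\<^bsub>BijGroup X\<^esub> b \<in> extensional X" "c \<otimes>\<^bsub>BijGroup X\<^esub> g \<in> extensional X"
      using assms m_closed[unfolded car] by (auto simp: Bij_def)
    moreover assume "\<forall>x\<in>X. g (b x) = c (g x)"
    ultimately show "g \<otimes>\<^bsub>BijGroup X\<^esub> b = c \<otimes>\<^bsub>BijGroup X\<^esub> g"
      by (intro extensionalityI) (use assms in \<open>auto simp: mult_BijGroup_apply\<close>)
  qed
  finally show ?thesis .
qed

lemma transpose_in_finitary_perms:
  assumes "x \<in> X" "y \<in> X"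
  shows "restrict (transpose x y) X \<in> finitary_perms X"
proof -
  have "bij_betw (transpose x y) X X"
    using assms by (intro bij_betwI[where g = "transpose x y"]) (auto simp: transpose_def)
  moreover have "finite {z \<in> X. restrict (transpose x y) X z \<noteq> z}"
    by (rule finite_subset[of _ "{x, y}"]) (auto simp: transpose_def split: if_splits)
  ultimately show ?thesis
    by (auto simp: finitary_perms_def BijGroup_def Bij_def cong: bij_betw_cong)
qed

section \<open>Sub-basic sets of the centralizer topology\<close>

locale permutation_subgroup =
  fixes X :: "'a set" and G :: "('a \<Rightarrow> 'a) set"
  assumes subgroup: "subgroup G (BijGroup X)"
begin

lemma subset_Bij: "G \<subseteq> Bij X"
  using subgroup.subset[OF subgroup] by (simp add: BijGroup_def)

lemma subset_PiE: "G \<subseteq> X \<rightarrow>\<^sub>E X"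
  using subset_Bij by (auto simp: Bij_def bij_betw_def PiE_def)

text \<open>The equation \<open>g b g\<inverse> = c\<close> with the inverse cleared, so that only
  evaluation at points of \<open>X\<close> remains. For \<open>c = b\<close> this is the centralizer
  of \<open>b\<close> in \<open>G\<close>.\<close>

definition conjugators :: "('a \<Rightarrow> 'a) \<Rightarrow> ('a \<Rightarrow> 'a) \<Rightarrow> ('a \<Rightarrow> 'a) set" where
  "conjugators b c = {g \<in> G. \<forall>x\<in>X. g (b x) = c (g x)}"

lemma centralizer_topology_eq:
  "centralizer_topology (BijGroup X\<lparr>carrier := G\<rparr>) = topology_generated_by
    {conjugators b (a \<otimes>\<^bsub>BijGroup X\<^esub> b \<otimes>\<^bsub>BijGroup X\<^esub> inv\<^bsub>BijGroup X\<^esub> a) | a b. a \<in> G \<and> b \<in> G}"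
proof -
  interpret group "BijGroup X" by (rule group_BijGroup)
  interpret subgroup G "BijGroup X" by (rule subgroup)
  have "a \<otimes>\<^bsub>BijGroup X\<^esub> b \<otimes>\<^bsub>BijGroup X\<^esub> inv\<^bsub>BijGroup X\<^esub> a \<in> Bij X" if "a \<in> G" "b \<in> G" for a b
    using that subset_Bij by blast
  then have "{g \<in> G. g \<otimes>\<^bsub>BijGroup X\<^esub> b \<otimes>\<^bsub>BijGroup X\<^esub> inv\<^bsub>BijGroup X\<lparr>carrier := G\<rparr>\<^esub> g =
      a \<otimes>\<^bsub>BijGroup X\<^esub> b \<otimes>\<^bsub>BijGroup X\<^esub> inv\<^bsub>BijGroup X\<lparr>carrier := G\<rparr>\<^esub> a} =
      conjugators b (a \<otimes>\<^bsub>BijGroup X\<^esub> b \<otimes>\<^bsub>BijGroup X\<^esub> inv\<^bsub>BijGroup X\<^esub> a)"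
    if "a \<in> G" "b \<in> G" for a b
    using that subset_Bij conjugate_BijGroup_eq_iff[of _ X b] m_inv_consistent[OF subgroup]
    unfolding conjugators_def by (auto simp: subset_iff)
  then show ?thesis
    unfolding centralizer_topology_def
    by (intro arg_cong[where f = topology_generated_by] Collect_cong iff_exI) (simp cong: rev_conj_cong)
qed

lemma in_conjugators_self:
  assumes "a \<in> G" "b \<in> G"
  shows "a \<in> conjugators b (a \<otimes>\<^bsub>BijGroup X\<^esub> b \<otimes>\<^bsub>BijGroup X\<^esub> inv\<^bsub>BijGroup X\<^esub> a)"
proof -
  interpret group "BijGroup X" by (rule group_BijGroup)
  interpret subgroup G "BijGroup X" by (rule subgroup)
  have "a \<otimes>\<^bsub>BijGroup X\<^esub> b \<otimes>\<^bsub>BijGroup X\<^esub> inv\<^bsub>BijGroup X\<^esub> a \<in> G"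
    using assms by blast
  then show ?thesis
    using assms subset_Bij conjugate_BijGroup_eq_iff[of a X b]
    by (auto simp: conjugators_def)
qed

lemma openin_centralizer_conjugators:
  assumes "a \<in> G" "b \<in> G"
  shows "openin (centralizer_topology (BijGroup X\<lparr>carrier := G\<rparr>))
    (conjugators b (a \<otimes>\<^bsub>BijGroup X\<^esub> b \<otimes>\<^bsub>BijGroup X\<^esub> inv\<^bsub>BijGroup X\<^esub> a))"
  unfolding centralizer_topology_eq using assms by (intro topology_generated_by_Basis) blast

text \<open>If \<open>g\<close> agrees with \<open>f\<close> on the finite support of
  \<open>b\<close>, the bijections \<open>f\<close> and \<open>g\<close> also carry the fixed points
  of \<open>b\<close> onto the same set, and \<open>c\<close> is the identity there.\<close>

lemma openin_pointwise_conjugators: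
  assumes b: "b \<in> finitary_perms X"
  shows "openin (pointwise_topology X G) (conjugators b c)"
  unfolding openin_pointwise_topology[OF subset_PiE]
proof (intro conjI ballI)
  show "conjugators b c \<subseteq> G" by (auto simp: conjugators_def)
  fix f assume f: "f \<in> conjugators b c"
  let ?F = "{x \<in> X. b x \<noteq> x}"
  have bb: "bij_betw b X X" and fin: "finite ?F"
    using b by (auto simp: finitary_perms_def BijGroup_def Bij_def)
  have bf: "bij_betw f X X" and ff: "\<And>x. x \<in> X \<Longrightarrow> f (b x) = c (f x)"
    using f subset_Bij by (auto simp: conjugators_def Bij_def)
  have "g \<in> conjugators b c" if g: "g \<in> G" "\<forall>x\<in>?F. g x = f x" for g
  proof -
    have bg: "bij_betw g X X" using g(1) subset_Bij by (auto simp: Bij_def)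
    have "g (b x) = c (g x)" if x: "x \<in> X" for x
    proof (cases "b x = x")
      case False
      \<comment> \<open>By injectivity \<open>b\<close> maps its support into itself, so
        \<open>g\<close> agrees with \<open>f\<close> at \<open>b x\<close> as well as at
        \<open>x\<close>.\<close>
      then have "b x \<in> ?F"
        using bb x bij_betwE[OF bb] inj_on_eq_iff[OF bij_betw_imp_inj_on[OF bb], of "b x" x] by auto
      then show ?thesis using False g(2) ff x by auto
    next
      case True
      have "g x \<in> f ` X" using bg bf x by (auto simp: bij_betw_def)
      then obtain y where y: "y \<in> X" "g x = f y" by auto
      \<comment> \<open>Otherwise \<open>y\<close> lies in the support, so
        \<open>g y = f y = g x\<close> and the fixed point \<open>x\<close> would equal the moved
        point \<open>y\<close>.\<close>
      have "b y = y"
      proof (rule ccontr)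
        assume "b y \<noteq> y"
        then have "g y = g x" using y g(2) by auto
        then have "x = y" using inj_onD[OF bij_betw_imp_inj_on[OF bg]] x y by metis
        then show False using True \<open>b y \<noteq> y\<close> by simp
      qed
      then show ?thesis using ff[OF y(1)] y True by simp
    qed
    then show ?thesis using g(1) by (simp add: conjugators_def)
  qed
  then show "\<exists>F. finite F \<and> F \<subseteq> X \<and> {g \<in> G. \<forall>x\<in>F. g x = f x} \<subseteq> conjugators b c"
    using fin by (intro exI[of _ ?F]) blast
qed

lemma centralizer_coarser_pointwise:
  assumes "G \<subseteq> finitary_perms X" "openin (centralizer_topology (BijGroup X\<lparr>carrier := G\<rparr>)) S"
  shows "openin (pointwise_topology X G) S"
  using assms(2) unfolding centralizer_topology_eq openin_topology_generated_by_iff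
  by (rule generate_topology_on_coarsest[rotated 2])
    (use assms(1) openin_pointwise_conjugators in auto)

section \<open>Recovering values from conjugated transpositions\<close>

text \<open>Read through \<open>f\<close>, the only points of \<open>X\<close> moved by
  \<open>c\<close> are \<open>f x\<close> and \<open>f u\<close>; read through \<open>g\<close>, the
  point \<open>g x\<close> is moved by \<open>c\<close>.\<close>

lemma conjugators_transpose_apply:
  assumes "x \<in> X" "u \<in> X" "x \<noteq> u"
    and f: "f \<in> conjugators (restrict (transpose x u) X) c"
    and g: "g \<in> conjugators (restrict (transpose x u) X) c"
  shows "g x = f x \<or> g x = f u"
proof -
  have bf: "bij_betw f X X" and bg: "bij_betw g X X"
    using f g subset_Bij by (auto simp: conjugators_def Bij_def)
  have "g x \<in> f ` X" using bg bf assms(1) by (auto simp: bij_betw_def)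
  then obtain y where y: "y \<in> X" "g x = f y" by auto
  have "g u = c (g x)" using g assms(1,2) by (auto simp: conjugators_def)
  moreover have "f (transpose x u y) = c (f y)" using f y(1) by (auto simp: conjugators_def)
  moreover have "g u \<noteq> g x" using bg assms(1-3) by (auto simp: bij_betw_def inj_on_eq_iff)
  ultimately have "transpose x u y \<noteq> y" using y by auto
  then show ?thesis using y by (auto simp: transpose_def split: if_splits)
qed

lemma pointwise_coarser_centralizer:
  assumes X: "infinite X \<or> card X \<ge> 3" and G: "finitary_perms X \<subseteq> G"
    and S: "openin (pointwise_topology X G) S"
  shows "openin (centralizer_topology (BijGroup X\<lparr>carrier := G\<rparr>)) S" (is "openin ?T S")
proof (subst openin_subopen, intro ballI)
  have point: "\<exists>U. openin ?T U \<and> f \<in> U \<and> (\<forall>g\<in>U. g x = f x)"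
    if x: "x \<in> X" and f: "f \<in> G" for x f
  proof -
    \<comment> \<open>A three-element subset treats finite and infinite \<open>X\<close> alike;
      removing \<open>x\<close> leaves at least two points, which serve as \<open>u\<close> and
      \<open>v\<close>.\<close>
    have "\<exists>Y. Y \<subseteq> X \<and> finite Y \<and> card Y = 3"
      using X infinite_arbitrarily_large obtain_subset_with_card_n by metis
    then obtain Y where "Y \<subseteq> X" "finite Y" "card Y = 3" by blast
    then have "card (Y - {x}) \<ge> 2" by (simp add: card_Diff_singleton_if)
    then obtain u v where uv: "u \<in> X" "v \<in> X" "u \<noteq> x" "v \<noteq> x" "u \<noteq> v"
      using \<open>Y \<subseteq> X\<close> by (auto simp: numeral_2_eq_2 card_le_Suc_iff)
    define s where "s = restrict (transpose x u) X"
    define t where "t = restrict (transpose x v) X"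
    have st: "s \<in> G" "t \<in> G"
      unfolding s_def t_def using x uv by (auto intro!: subsetD[OF G] transpose_in_finitary_perms)
    define U where "U =
      conjugators s (f \<otimes>\<^bsub>BijGroup X\<^esub> s \<otimes>\<^bsub>BijGroup X\<^esub> inv\<^bsub>BijGroup X\<^esub> f) \<inter>
      conjugators t (f \<otimes>\<^bsub>BijGroup X\<^esub> t \<otimes>\<^bsub>BijGroup X\<^esub> inv\<^bsub>BijGroup X\<^esub> f)"
    have "openin ?T U"
      unfolding U_def using f st by (intro openin_Int openin_centralizer_conjugators)
    moreover have fU: "f \<in> U"
      unfolding U_def using f st in_conjugators_self by blast
    moreover have "g x = f x" if "g \<in> U" for g
    proof -
      have "g x = f x \<or> g x = f u" "g x = f x \<or> g x = f v"
        using that fU x uv conjugators_transpose_apply unfolding U_def s_def t_def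
        by (metis IntD1 IntD2)+
      \<comment> \<open>Hence the two alternatives for \<open>g x\<close> have only
        \<open>f x\<close> in common.\<close>
      moreover have "f u \<noteq> f v"
        using f subset_Bij uv by (auto simp: Bij_def bij_betw_def inj_on_eq_iff)
      ultimately show ?thesis by auto
    qed
    ultimately show ?thesis by blast
  qed
  fix f assume "f \<in> S"
  then obtain F where f: "f \<in> G" and F: "finite F" "F \<subseteq> X" "{g \<in> G. \<forall>x\<in>F. g x = f x} \<subseteq> S"
    using S unfolding openin_pointwise_topology[OF subset_PiE] by blast
  obtain U where U: "\<And>x. x \<in> X \<Longrightarrow> openin ?T (U x)" "\<And>x. x \<in> X \<Longrightarrow> f \<in> U x"
    "\<And>x g. x \<in> X \<Longrightarrow> g \<in> U x \<Longrightarrow> g x = f x"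
    using point[OF _ f] by metis
  \<comment> \<open>An open neighbourhood of \<open>f\<close> contained in \<open>G\<close>. It
    keeps the intersection below inside \<open>G\<close> even for empty \<open>F\<close>, when the
    intersection of the \<open>U x\<close> is the whole type.\<close>
  define W where
    "W = conjugators f (f \<otimes>\<^bsub>BijGroup X\<^esub> f \<otimes>\<^bsub>BijGroup X\<^esub> inv\<^bsub>BijGroup X\<^esub> f)"
  have W: "openin ?T W" "f \<in> W"
    unfolding W_def by (rule openin_centralizer_conjugators[OF f f], rule in_conjugators_self[OF f f])
  have "openin ?T (W \<inter> (\<Inter>x\<in>F. U x))"
  proof (cases "F = {}")
    case False
    then show ?thesis
      using F(1,2) U(1) by (intro openin_Int[OF W(1)] openin_INT2) auto
  qed (simp add: W(1))
  moreover have "W \<inter> (\<Inter>x\<in>F. U x) \<subseteq> S"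
  proof -
    have "W \<subseteq> G" by (auto simp: W_def conjugators_def)
    then have "W \<inter> (\<Inter>x\<in>F. U x) \<subseteq> {g \<in> G. \<forall>x\<in>F. g x = f x}"
      using U(3) F(2) by (auto dest: subsetD)
    then show ?thesis using F(3) by (rule subset_trans)
  qed
  moreover have "f \<in> W \<inter> (\<Inter>x\<in>F. U x)"
    using \<open>f \<in> W\<close> F(2) U(2) by blast
  ultimately show "\<exists>T. openin ?T T \<and> f \<in> T \<and> T \<subseteq> S" by blast
qed

section \<open>Centralizers of permutations with infinite support\<close>

lemma finitary_if_openin_pointwise_centralizer:
  assumes G: "finitary_perms X \<subseteq> G" and b: "b \<in> G"
    and op: "openin (pointwise_topology X G) (conjugators b b)"
  shows "b \<in> finitary_perms X"
proof (rule ccontr)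
  assume "b \<notin> finitary_perms X"
  then have inf: "infinite {x \<in> X. b x \<noteq> x}"
    using b subset_Bij by (auto simp: finitary_perms_def BijGroup_def)
  have bb: "bij_betw b X X" using b subset_Bij by (auto simp: Bij_def)
  define e where "e = restrict id X"
  have "e \<in> G"
    using subgroup.one_closed[OF subgroup] by (simp add: BijGroup_def e_def id_def)
  then have "e \<in> conjugators b b"
    using bij_betwE[OF bb] by (auto simp: conjugators_def e_def)
  then obtain F where F: "finite F" "F \<subseteq> X" "{g \<in> G. \<forall>x\<in>F. g x = e x} \<subseteq> conjugators b b"
    using op unfolding openin_pointwise_topology[OF subset_PiE] by blast
  obtain x where x: "x \<in> X" "b x \<noteq> x" "x \<notin> F"
    using infinite_imp_nonempty[OF Diff_infinite_finite[OF F(1) inf]] by blast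
  have "infinite X" using inf finite_subset[of "{x \<in> X. b x \<noteq> x}" X] by blast
  \<comment> \<open>The transposition of \<open>x\<close> and \<open>z\<close> must fix
    \<open>F\<close> pointwise, hence \<open>z\<close> is chosen outside \<open>F\<close>; it must
    also fix \<open>b x\<close>, hence \<open>z\<close> differs from \<open>b x\<close>.\<close>
  then have "X - (F \<union> {x, b x}) \<noteq> {}"
    using F(1) by (intro infinite_imp_nonempty Diff_infinite_finite) auto
  then obtain z where z: "z \<in> X" "z \<notin> F" "z \<noteq> x" "z \<noteq> b x" by blast
  define t where "t = restrict (transpose x z) X"
  have "t \<in> G" unfolding t_def by (rule subsetD[OF G transpose_in_finitary_perms[OF x(1) z(1)]])
  moreover have "\<forall>y\<in>F. t y = e y"
    using F(2) x(3) z(2) by (auto simp: t_def e_def transpose_def)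
  ultimately have "t (b x) = b (t x)"
    using F(3) x(1) by (auto simp: conjugators_def)
  \<comment> \<open>Here \<open>t (b x) = b x\<close>, whereas \<open>t x = z\<close>.\<close>
  then have "b x = b z"
    using x z bij_betwE[OF bb] by (auto simp: t_def transpose_def split: if_splits)
  then show False
    using bb x(1) z(1,3) by (auto simp: bij_betw_def inj_on_eq_iff)
qed

end

theorem theorem5p3:
  fixes X :: "'a set" and G :: "('a \<Rightarrow> 'a) set"
  assumes "infinite X \<or> card X \<ge> 3"
    and "subgroup G (BijGroup X)"
    and "finitary_perms X \<subseteq> G"
  shows "pointwise_topology X G = centralizer_topology (BijGroup X\<lparr>carrier := G\<rparr>)
    \<longleftrightarrow> G = finitary_perms X"
proof -
  interpret permutation_subgroup X G by (rule permutation_subgroup.intro) (rule assms(2))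
  interpret B: group "BijGroup X" by (rule group_BijGroup)
  show ?thesis
  proof
    assume eq: "pointwise_topology X G = centralizer_topology (BijGroup X\<lparr>carrier := G\<rparr>)"
    have "b \<in> finitary_perms X" if b: "b \<in> G" for b
    proof (rule finitary_if_openin_pointwise_centralizer[OF assms(3) b])
      have "b \<in> carrier (BijGroup X)" using subgroup.subset[OF assms(2)] b by blast
      \<comment> \<open>Taking \<open>a = b\<close> turns a sub-basic set into the centralizer of
        \<open>b\<close>.\<close>
      then have "b \<otimes>\<^bsub>BijGroup X\<^esub> b \<otimes>\<^bsub>BijGroup X\<^esub> inv\<^bsub>BijGroup X\<^esub> b = b"
        by (simp add: B.m_assoc)
      then show "openin (pointwise_topology X G) (conjugators b b)"
        using openin_centralizer_conjugators[OF b b] by (simp add: eq)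
    qed
    then show "G = finitary_perms X" using assms(3) by blast
  next
    assume "G = finitary_perms X"
    then show "pointwise_topology X G = centralizer_topology (BijGroup X\<lparr>carrier := G\<rparr>)"
      unfolding topology_eq
      using pointwise_coarser_centralizer[OF assms(1,3)] centralizer_coarser_pointwise by blast
  qed
qed

end
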